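(* Let $K,L\subset\mathbb R^n$ be convex bodies satisfying $M(K,L)=|K\cap(-L)|$. Then, for every $\theta\in(0,1)$, $$K+_\theta L\ \supseteq\ (1-\theta)\,M(K,L)\,\operatorname{conv}\left(\Pi^*K\cup\Pi^*L\right).$$
   Context: A convex body in $\mathbb R^n$ is a compact convex set with non-empty interior; $|\cdot|$ denotes Lebesgue measure (of the appropriate dimension) for sets and the Euclidean norm for vectors. $K+L$ is the Minkowski sum, $M(K,L)=\sup_{x\in K+L}|K\cap(x-L)|$, and for $\theta\in[0,1]$, $K+_\theta L=\{x\in K+L:\ |K\cap(x-L)|\ge\theta M(K,L)\}$. $\Pi^*K$ is the polar projection body of $K$, i.e. the unit ball of the norm $\|x\|_{\Pi^*K}=|x|\,|P_{x^\perp}K|$ (equal to $0$ at $x=0$), where $P_{x^\perp}$ is the orthogonal projection onto the hyperplane orthogonal to $x$ and $|P_{x^\perp}K|$ is the $(n-1)$-dimensional volume. $\operatorname{conv}$ denotes the convex hull. *)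

theory Defs
  imports "HOL-Analysis.Analysis" "HOL-Library.Set_Algebras"
begin

definition convex_body :: "'a::euclidean_space set \<Rightarrow> bool" where
  "convex_body K \<longleftrightarrow> compact K \<and> convex K \<and> interior K \<noteq> {}"

text \<open>On sets, binary and unary minus are set difference and complement, so reflected
  and translated copies such as \<open>x - L\<close> are written as images.\<close>

definition conv_vol :: "'a::euclidean_space set \<Rightarrow> 'a set \<Rightarrow> 'a \<Rightarrow> real" where
  "conv_vol K L x = measure lebesgue (K \<inter> (\<lambda>y. x - y) ` L)"

definition max_conv_vol :: "'a::euclidean_space set \<Rightarrow> 'a set \<Rightarrow> real" where
  "max_conv_vol K L = (SUP x\<in>K + L. conv_vol K L x)"

definition theta_conv :: "real \<Rightarrow> 'a::euclidean_space set \<Rightarrow> 'a set \<Rightarrow> 'a set" where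
  "theta_conv \<theta> K L = {x \<in> K + L. conv_vol K L x \<ge> \<theta> * max_conv_vol K L}"

definition orthonormal_basis_of :: "'a::euclidean_space set \<Rightarrow> 'a set \<Rightarrow> bool" where
  "orthonormal_basis_of S B \<longleftrightarrow>
     pairwise orthogonal B \<and> (\<forall>b\<in>B. norm b = 1) \<and> span B = S"

text \<open>Lebesgue measure of dimension \<open>dim S\<close> on a linear subspace \<open>S\<close>, as a Borel measure on the
  ambient space: the construction of \<open>lborel\<close> with \<open>Basis\<close> replaced by an orthonormal basis
  of \<open>S\<close>. The result does not depend on the chosen basis. For \<open>S = {0}\<close> it is
  the unit point mass at the origin.\<close>

definition subspace_lborel :: "'a::euclidean_space set \<Rightarrow> 'a measure" where
  "subspace_lborel S =
     (let B = (SOME B. orthonormal_basis_of S B)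
      in distr (\<Pi>\<^sub>M b\<in>B. lborel) borel (\<lambda>f. \<Sum>b\<in>B. f b *\<^sub>R b))"

definition orth_hyperplane :: "'a::euclidean_space \<Rightarrow> 'a set" where
  "orth_hyperplane x = {y. orthogonal x y}"

definition proj_orth :: "'a::euclidean_space \<Rightarrow> 'a \<Rightarrow> 'a" where
  "proj_orth x y = y - ((x \<bullet> y) / (x \<bullet> x)) *\<^sub>R x"

definition proj_vol :: "'a::euclidean_space set \<Rightarrow> 'a \<Rightarrow> real" where
  "proj_vol K x = measure (subspace_lborel (orth_hyperplane x)) (proj_orth x ` K)"

definition polar_proj_norm :: "'a::euclidean_space set \<Rightarrow> 'a \<Rightarrow> real" where
  "polar_proj_norm K x = (if x = 0 then 0 else norm x * proj_vol K x)"

definition polar_proj_body :: "'a::euclidean_space set \<Rightarrow> 'a set" where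
  "polar_proj_body K = {x. polar_proj_norm K x \<le> 1}"

end

theory Submission
  imports Defs
begin

text \<open>
  Let \<open>\<phi>\<^sub>K(v)\<close> (\<open>shift_defect\<close> below) be the volume of the points of \<open>K\<close> that leave \<open>K\<close> when
  translated by \<open>v\<close>. It is subadditive in \<open>v\<close>, and since each line parallel to \<open>v\<close> meets \<open>K\<close> in
  a segment, Fubini gives \<open>\<phi>\<^sub>K(v) \<le> \<bar>v\<bar> \<bar>P K\<bar>\<close>, where \<open>P\<close> projects along \<open>v\<close>. Hence
  \<open>\<phi>\<^sub>K(t x) \<le> t\<close> for \<open>x \<in> \<Pi>\<^sup>*K\<close>. Moving \<open>K\<close> by \<open>p\<close> and \<open>L\<close> by \<open>q\<close> decreases \<open>\<bar>K \<inter> (- L)\<bar>\<close> by at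
  most \<open>\<phi>\<^sub>K(p) + \<phi>\<^sub>L(q)\<close>. A point \<open>x\<close> of the convex hull is a convex combination of points of the
  two bodies, so \<open>c x = p + q\<close> with \<open>\<phi>\<^sub>K(p) + \<phi>\<^sub>L(q) \<le> c\<close>; take \<open>c = (1 - \<theta>) M(K, L)\<close>.
\<close>

section \<open>Lebesgue measure in orthonormal coordinates\<close>

lemma nn_integral_lborel_translate:
  fixes f :: "'a::euclidean_space \<Rightarrow> ennreal"
  assumes [measurable]: "f \<in> borel_measurable borel"
  shows "(\<integral>\<^sup>+x. f (c + x) \<partial>lborel) = (\<integral>\<^sup>+x. f x \<partial>lborel)"
proof -
  have "(\<integral>\<^sup>+x. f x \<partial>lborel) = (\<integral>\<^sup>+x. f x \<partial>(distr lborel borel ((+) c)))"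
    by (simp add: lborel_distr_plus)
  also have "\<dots> = (\<integral>\<^sup>+x. f (c + x) \<partial>lborel)"
    by (subst nn_integral_distr) simp_all
  finally show ?thesis by simp
qed

text \<open>By the uniqueness argument for Haar measure the image measure is a multiple of Lebesgue
  measure, and the unit ball, which \<open>T\<close> preserves, shows that the factor is 1.\<close>

lemma distr_lborel_linear_isometry:
  fixes T :: "'a::euclidean_space \<Rightarrow> 'a"
  assumes lin: "linear T" and iso: "\<And>x. norm (T x) = norm x"
  shows "distr lborel borel T = lborel"
proof (rule measure_eqI)
  fix A :: "'a set" assume "A \<in> sets (distr lborel borel T)"
  then have A[measurable]: "A \<in> sets borel" by simp
  have T[measurable]: "T \<in> borel_measurable borel"
    using lin by (intro borel_measurable_continuous_onI linear_continuous_on linear_conv_bounded_linear[THEN iffD1])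
  have "inj T"
    using iso lin by (metis linear_injective_0 norm_eq_zero)
  then have surj: "surj T"
    using lin linear_injective_imp_surjective by blast
  define C where "C = ball (0::'a) 1"
  have C[measurable]: "C \<in> sets borel" by (simp add: C_def)
  let ?c = "emeasure lborel C"
  have c: "?c \<noteq> 0" "?c \<noteq> \<infinity>"
    using emeasure_lborel_ball_finite[of "0::'a" 1] open_not_negligible[of C]
    by (auto simp: negligible_iff_emeasure0 C_def)
  \<comment> \<open>The unit ball is symmetric about the origin, so translation invariance alone
    gives this, without invariance under reflection.\<close>
  have ball_sym: "(\<integral>\<^sup>+y. indicator C (a - y) \<partial>lborel) = ?c" for a :: 'a
  proof -
    have "(\<integral>\<^sup>+y. indicator C (a - y) \<partial>lborel) = (\<integral>\<^sup>+y. indicator C (- a + y) \<partial>lborel)"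
      by (intro nn_integral_cong) (auto simp: C_def indicator_def norm_minus_commute)
    also have "\<dots> = ?c"
      by (subst nn_integral_lborel_translate) simp_all
    finally show ?thesis .
  qed
  have "emeasure (distr lborel borel T) A * ?c
      = (\<integral>\<^sup>+x. indicator A (T x) * ?c \<partial>lborel)"
  proof -
    have "emeasure (distr lborel borel T) A = (\<integral>\<^sup>+x. indicator A x \<partial>distr lborel borel T)"
      by simp
    also have "\<dots> = (\<integral>\<^sup>+x. indicator A (T x) \<partial>lborel)"
      by (rule nn_integral_distr) simp_all
    finally show ?thesis
      by (simp add: nn_integral_multc)
  qed
  \<comment> \<open>The constant \<open>?c\<close> is written as the volume of a ball around
    \<open>T x\<close>. This double integral is then evaluated in the other order, so that the
    factor containing \<open>A\<close> ends up integrated against plain translations in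
    \<open>y\<close>.\<close>
  also have "\<dots> = (\<integral>\<^sup>+x. (\<integral>\<^sup>+y. indicator A (T x) * indicator C (T x - y) \<partial>lborel) \<partial>lborel)"
  proof (rule nn_integral_cong)
    fix x
    show "indicator A (T x) * ?c = (\<integral>\<^sup>+y. indicator A (T x) * indicator C (T x - y) \<partial>lborel)"
      unfolding ball_sym[of "T x", symmetric] by (rule nn_integral_cmult[symmetric]) measurable
  qed
  also have "\<dots> = (\<integral>\<^sup>+y. (\<integral>\<^sup>+x. indicator A (T x) * indicator C (T x - y) \<partial>lborel) \<partial>lborel)"
    by (rule lborel_pair.Fubini') measurable
  also have "\<dots> = (\<integral>\<^sup>+y. (\<integral>\<^sup>+x. indicator A (x + y) * indicator C x \<partial>distr lborel borel T) \<partial>lborel)"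
  proof (rule nn_integral_cong)
    fix y :: 'a
    \<comment> \<open>Surjectivity turns a shift by \<open>y\<close> after \<open>T\<close> into a
      shift by \<open>z\<close> of the integration variable, which Lebesgue measure ignores.\<close>
    obtain z where z: "y = T z" using surj by blast
    have "(\<integral>\<^sup>+x. indicator A (T x) * indicator C (T x - y) \<partial>lborel)
        = (\<integral>\<^sup>+x. indicator A (T (z + x)) * indicator C (T (z + x) - y) \<partial>lborel)"
      by (rule nn_integral_lborel_translate[symmetric]) measurable
    also have "\<dots> = (\<integral>\<^sup>+x. indicator A (T x + y) * indicator C (T x) \<partial>lborel)"
      by (simp add: linear_add[OF lin] z add.commute)
    also have "\<dots> = (\<integral>\<^sup>+x. indicator A (x + y) * indicator C x \<partial>distr lborel borel T)"
      by (subst nn_integral_distr) simp_all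
    finally show "(\<integral>\<^sup>+x. indicator A (T x) * indicator C (T x - y) \<partial>lborel)
        = (\<integral>\<^sup>+x. indicator A (x + y) * indicator C x \<partial>distr lborel borel T)" .
  qed
  \<comment> \<open>The isometry enters here: \<open>T x\<close> lies in the unit ball exactly when
    \<open>x\<close> does.\<close>
  also have "\<dots> = (\<integral>\<^sup>+y. (\<integral>\<^sup>+x. indicator A (T x + y) * indicator C x \<partial>lborel) \<partial>lborel)"
    by (subst nn_integral_distr) (auto intro!: nn_integral_cong simp: C_def indicator_def iso)
  also have "\<dots> = (\<integral>\<^sup>+x. (\<integral>\<^sup>+y. indicator A (T x + y) * indicator C x \<partial>lborel) \<partial>lborel)"
    by (rule lborel_pair.Fubini') measurable
  also have "\<dots> = (\<integral>\<^sup>+x. emeasure lborel A * indicator C x \<partial>lborel)"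
    by (simp add: nn_integral_multc nn_integral_lborel_translate)
  also have "\<dots> = emeasure lborel A * ?c"
    by (simp add: nn_integral_cmult)
  finally show "emeasure (distr lborel borel T) A = emeasure lborel A"
    using c by (simp add: mult.commute[of _ ?c] ennreal_mult_cancel_left)
qed simp

text \<open>A product measure is determined by its values on boxes. The preimage of a box is the box
  with its sides relabelled, and since all factors are the same measure the product of the side
  lengths does not change.\<close>

lemma PiM_lborel_reindex:
  fixes \<pi> :: "'i \<Rightarrow> 'j"
  assumes "finite I" and bij: "bij_betw \<pi> I J"
  shows "distr (\<Pi>\<^sub>M j\<in>J. (lborel :: real measure)) (\<Pi>\<^sub>M i\<in>I. lborel) (\<lambda>f. \<lambda>i\<in>I. f (\<pi> i))
       = (\<Pi>\<^sub>M i\<in>I. lborel)"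
proof -
  interpret I: product_sigma_finite "\<lambda>_::'i. lborel :: real measure" ..
  interpret J: product_sigma_finite "\<lambda>_::'j. lborel :: real measure" ..
  have finJ: "finite J" using assms bij_betw_finite by blast
  have maps: "\<pi> i \<in> J" if "i \<in> I" for i using bij that by (auto simp: bij_betw_def)
  let ?inv = "inv_into I \<pi>"
  have inv: "?inv j \<in> I" "\<pi> (?inv j) = j" if "j \<in> J" for j
    using bij that by (auto simp: bij_betw_def inv_into_into f_inv_into_f)
  have inv': "?inv (\<pi> i) = i" if "i \<in> I" for i
    using bij that by (simp add: bij_betw_inv_into_left)
  have m[measurable]: "(\<lambda>f. \<lambda>i\<in>I. f (\<pi> i)) \<in> (\<Pi>\<^sub>M j\<in>J. (lborel :: real measure)) \<rightarrow>\<^sub>M (\<Pi>\<^sub>M i\<in>I. lborel)"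
    by (intro measurable_restrict measurable_component_singleton maps)
  show ?thesis
  proof (rule I.PiM_eqI)
    fix A :: "'i \<Rightarrow> real set" assume A: "\<And>i. i \<in> I \<Longrightarrow> A i \<in> sets lborel"
    have "(\<lambda>f. \<lambda>i\<in>I. f (\<pi> i)) -` Pi\<^sub>E I A \<inter> space (\<Pi>\<^sub>M j\<in>J. (lborel :: real measure))
        = (\<Pi>\<^sub>E j\<in>J. A (?inv j))"
    proof (intro set_eqI iffI)
      fix f assume f: "f \<in> (\<lambda>f. \<lambda>i\<in>I. f (\<pi> i)) -` Pi\<^sub>E I A \<inter> space (\<Pi>\<^sub>M j\<in>J. (lborel :: real measure))"
      have "f j \<in> A (?inv j)" if "j \<in> J" for j
        using f inv[OF that] by (auto simp: PiE_iff)
      with f show "f \<in> (\<Pi>\<^sub>E j\<in>J. A (?inv j))"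
        by (auto simp: space_PiM PiE_iff)
    next
      fix f assume f: "f \<in> (\<Pi>\<^sub>E j\<in>J. A (?inv j))"
      have "f (\<pi> i) \<in> A i" if "i \<in> I" for i
        using f maps[OF that] inv'[OF that] by (auto simp: PiE_iff)
      with f show "f \<in> (\<lambda>f. \<lambda>i\<in>I. f (\<pi> i)) -` Pi\<^sub>E I A \<inter> space (\<Pi>\<^sub>M j\<in>J. (lborel :: real measure))"
        by (auto simp: space_PiM PiE_iff)
    qed
    moreover have "emeasure (\<Pi>\<^sub>M j\<in>J. (lborel :: real measure)) (\<Pi>\<^sub>E j\<in>J. A (?inv j))
        = (\<Prod>j\<in>J. emeasure lborel (A (?inv j)))"
      using A inv finJ by (intro J.emeasure_PiM) auto
    moreover have "\<dots> = (\<Prod>i\<in>I. emeasure lborel (A i))"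
      using prod.reindex_bij_betw[OF bij, of "\<lambda>j. emeasure lborel (A (?inv j))"] inv' by simp
    moreover have "Pi\<^sub>E I A \<in> sets (\<Pi>\<^sub>M i\<in>I. (lborel :: real measure))"
      using A assms by (intro sets_PiM_I_finite) auto
    ultimately show "emeasure (distr (\<Pi>\<^sub>M j\<in>J. lborel) (\<Pi>\<^sub>M i\<in>I. lborel) (\<lambda>f. \<lambda>i\<in>I. f (\<pi> i))) (Pi\<^sub>E I A)
        = (\<Prod>i\<in>I. emeasure lborel (A i))"
      by (simp add: emeasure_distr)
  qed (use assms in auto)
qed

lemma orthonormal_basis_of_finite_independent:
  fixes B :: "'a::euclidean_space set"
  assumes "orthonormal_basis_of S B"
  shows "finite B" and "independent B"
proof -
  have "0 \<notin> B" using assms by (auto simp: orthonormal_basis_of_def)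
  then show "independent B"
    using assms by (simp add: orthonormal_basis_of_def pairwise_orthogonal_independent)
  then show "finite B" by (simp add: independent_imp_finite)
qed

text \<open>A bijection from \<open>Basis\<close> to \<open>B\<close> extends to a linear isometry
  \<open>T\<close>, which preserves \<open>lborel\<close>. Pushing the coordinate description of
  \<open>lborel\<close> through \<open>T\<close> replaces \<open>Basis\<close> by \<open>B\<close>,
  up to a relabelling of the coordinates.\<close>

lemma lborel_eq_orthonormal_basis:
  fixes B :: "'a::euclidean_space set"
  assumes B: "orthonormal_basis_of UNIV B"
  shows "lborel = distr (\<Pi>\<^sub>M b\<in>B. lborel) borel (\<lambda>f. \<Sum>b\<in>B. f b *\<^sub>R b)"
proof -
  note fin = orthonormal_basis_of_finite_independent(1)[OF B]
  have "card B = DIM('a)"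
    using orthonormal_basis_of_finite_independent(2)[OF B] B
    by (metis dim_UNIV dim_span_eq_card_independent orthonormal_basis_of_def)
  then obtain \<pi> where \<pi>: "bij_betw \<pi> (Basis :: 'a set) B"
    by (metis bij_betw_iff_card fin finite_Basis)
  then have \<pi>B: "\<pi> i \<in> B" if "i \<in> Basis" for i using that by (auto simp: bij_betw_def)
  have \<pi>inner: "\<pi> i \<bullet> \<pi> j = (if i = j then 1 else 0)" if "i \<in> Basis" "j \<in> Basis" for i j
    using B \<pi>B[OF that(1)] \<pi>B[OF that(2)] bij_betw_imp_inj_on[OF \<pi>] that
    by (auto simp: orthonormal_basis_of_def pairwise_def orthogonal_def inj_on_eq_iff norm_eq_1)
  define T where "T x = (\<Sum>i\<in>Basis. (x \<bullet> i) *\<^sub>R \<pi> i)" for x :: 'a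
  have lin: "linear T"
    unfolding T_def by (intro linearI) (simp_all add: inner_add_left scaleR_add_left sum.distrib scaleR_sum_right)
  have iso: "norm (T x) = norm x" for x
  proof -
    have "T x \<bullet> T x = (\<Sum>i\<in>Basis. \<Sum>j\<in>Basis. (x \<bullet> i) * ((x \<bullet> j) * (\<pi> j \<bullet> \<pi> i)))"
      by (simp add: T_def inner_sum_left inner_sum_right sum_distrib_left)
    also have "\<dots> = (\<Sum>i\<in>Basis. (x \<bullet> i) * (x \<bullet> i))"
      by (intro sum.cong refl) (simp add: \<pi>inner if_distrib cong: if_cong sum.cong)
    also have "\<dots> = x \<bullet> x" by (simp flip: euclidean_inner)
    finally show ?thesis by (simp add: norm_eq_sqrt_inner)
  qed
  have T[measurable]: "T \<in> borel_measurable borel"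
    using lin by (intro borel_measurable_continuous_onI linear_continuous_on linear_conv_bounded_linear[THEN iffD1])
  have m[measurable]: "(\<lambda>f. \<lambda>i\<in>Basis. f (\<pi> i)) \<in> (\<Pi>\<^sub>M j\<in>B. (lborel :: real measure)) \<rightarrow>\<^sub>M (\<Pi>\<^sub>M i\<in>Basis. lborel)"
    by (intro measurable_restrict measurable_component_singleton \<pi>B)
  have "lborel = distr lborel borel T"
    by (rule distr_lborel_linear_isometry[OF lin iso, symmetric])
  also have "\<dots> = distr (\<Pi>\<^sub>M b\<in>Basis. lborel) borel (\<lambda>f. T (\<Sum>b\<in>Basis. f b *\<^sub>R b))"
    by (subst lborel_eq, subst distr_distr) (simp_all add: comp_def)
  also have "\<dots> = distr (\<Pi>\<^sub>M b\<in>Basis. lborel) borel (\<lambda>f. \<Sum>i\<in>Basis. f i *\<^sub>R \<pi> i)"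
    by (simp add: T_def)
  also have "\<dots> = distr (\<Pi>\<^sub>M b\<in>B. lborel) borel (\<lambda>f. \<Sum>i\<in>Basis. f (\<pi> i) *\<^sub>R \<pi> i)"
    by (subst PiM_lborel_reindex[OF finite_Basis \<pi>, symmetric], subst distr_distr) (simp_all add: comp_def)
  also have "(\<lambda>f. \<Sum>i\<in>Basis. f (\<pi> i) *\<^sub>R \<pi> i) = (\<lambda>f. \<Sum>b\<in>B. f b *\<^sub>R b)"
    using sum.reindex_bij_betw[OF \<pi>] by fastforce
  finally show ?thesis .
qed

text \<open>The set fits into the interval of length \<open>d\<close> that starts at its infimum.
  This bounds the part of a line that leaves a convex set under a shift.\<close>

lemma emeasure_lborel_le_diameter:
  fixes A :: "real set"
  assumes "0 \<le> d" and A: "\<And>x y. x \<in> A \<Longrightarrow> y \<in> A \<Longrightarrow> y - x \<le> d"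
  shows "emeasure lborel A \<le> ennreal d"
proof (cases "A = {}")
  case False
  then obtain a where a: "a \<in> A" by blast
  have bdd: "bdd_below A"
    using A[OF _ a] by (intro bdd_belowI[of _ "a - d"]) (smt (verit))
  have "A \<subseteq> {Inf A .. Inf A + d}"
  proof
    fix y assume y: "y \<in> A"
    have "y - d \<le> Inf A"
      using False A[OF _ y] by (intro cInf_greatest) (auto simp: algebra_simps)
    then show "y \<in> {Inf A .. Inf A + d}"
      using cInf_lower[OF y bdd] by auto
  qed
  then have "emeasure lborel A \<le> emeasure lborel {Inf A .. Inf A + d}"
    by (intro emeasure_mono) auto
  then show ?thesis using \<open>0 \<le> d\<close> by simp
qed simp

section \<open>Orthonormal coordinates adapted to a hyperplane and its normal\<close>

lemma subspace_orth_hyperplane: "subspace (orth_hyperplane v)"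
  by (auto simp: subspace_def orth_hyperplane_def orthogonal_clauses)

lemma orthonormal_basis_of_exists:
  assumes "subspace S"
  obtains B where "orthonormal_basis_of S B"
  using orthonormal_basis_subspace[OF assms] unfolding orthonormal_basis_of_def by metis

text \<open>Removing from a vector its component along \<open>u\<close> leaves a vector of the
  hyperplane, hence of \<open>span B\<close>. The extended basis expresses the whole space as
  hyperplane times normal line, the form in which Fubini is applied.\<close>

lemma orthonormal_basis_of_insert_normal:
  fixes v :: "'a::euclidean_space"
  assumes v: "v \<noteq> 0" and B: "orthonormal_basis_of (orth_hyperplane v) B"
  defines "u \<equiv> v /\<^sub>R norm v"
  shows "u \<notin> B" and "orthonormal_basis_of UNIV (insert u B)"
proof -
  have u1: "u \<bullet> u = 1"
    using v by (simp add: u_def dot_square_norm power2_eq_square)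
  have Bv: "v \<bullet> b = 0" if "b \<in> B" for b
    using B span_base[OF that] by (auto simp: orthonormal_basis_of_def orth_hyperplane_def orthogonal_def)
  have Bu: "u \<bullet> b = 0" if "b \<in> B" for b
    using Bv[OF that] by (simp add: u_def)
  show "u \<notin> B" using Bu u1 by auto
  have "x \<in> span (insert u B)" for x
  proof -
    have "v = norm v *\<^sub>R u" using v by (simp add: u_def)
    then have "v \<bullet> (x - (x \<bullet> u) *\<^sub>R u) = norm v * (u \<bullet> x - (x \<bullet> u) * (u \<bullet> u))"
      by (metis inner_diff_right inner_scaleR_left inner_scaleR_right)
    then have "x - (x \<bullet> u) *\<^sub>R u \<in> span B"
      using B by (simp add: orthonormal_basis_of_def orth_hyperplane_def orthogonal_def u1 inner_commute)
    then show ?thesis by (auto simp: span_insert)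
  qed
  moreover have "pairwise orthogonal (insert u B)"
    using B Bu by (auto simp: orthonormal_basis_of_def pairwise_insert orthogonal_def inner_commute)
  moreover have "norm u = 1" using u1 by (simp add: norm_eq_1)
  ultimately show "orthonormal_basis_of UNIV (insert u B)"
    using B by (auto simp: orthonormal_basis_of_def)
qed

text \<open>The basis obtained is the very one selected by \<open>SOME\<close> in the definition;
  existence of an orthonormal basis makes that selection meaningful.\<close>

lemma subspace_lborel_eq:
  assumes "subspace S"
  obtains B where "orthonormal_basis_of S B"
    and "subspace_lborel S = distr (\<Pi>\<^sub>M b\<in>B. lborel) borel (\<lambda>f. \<Sum>b\<in>B. f b *\<^sub>R b)"
proof -
  have "orthonormal_basis_of S (SOME B. orthonormal_basis_of S B)"
    using orthonormal_basis_of_exists[OF assms] by (metis someI)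
  then show thesis
    by (rule that) (simp add: subspace_lborel_def Let_def)
qed

text \<open>By Cauchy-Schwarz every coordinate of a point of \<open>P\<close> is at most its norm in
  absolute value, so in coordinates \<open>P\<close> lies in a cube. Finiteness is what lets the
  real-valued \<open>proj_vol\<close> stand for the \<open>emeasure\<close> of a projection.\<close>

lemma emeasure_subspace_lborel_bounded_finite:
  fixes S :: "'a::euclidean_space set"
  assumes "subspace S" and "bounded P" and P[measurable]: "P \<in> sets borel"
  shows "emeasure (subspace_lborel S) P < \<infinity>"
proof -
  obtain B where B: "orthonormal_basis_of S B"
    and eq: "subspace_lborel S = distr (\<Pi>\<^sub>M b\<in>B. lborel) borel (\<lambda>f. \<Sum>b\<in>B. f b *\<^sub>R b)"
    by (rule subspace_lborel_eq[OF assms(1)])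
  note fin = orthonormal_basis_of_finite_independent(1)[OF B]
  interpret product_sigma_finite "\<lambda>_::'a. lborel :: real measure" ..
  obtain R where R: "\<And>x. x \<in> P \<Longrightarrow> norm x \<le> R"
    using assms(2) bounded_iff by blast
  have comp: "(\<Sum>b\<in>B. f b *\<^sub>R b) \<bullet> c = f c" if "c \<in> B" for f :: "'a \<Rightarrow> real" and c
  proof -
    have "b \<bullet> c = (if b = c then 1 else 0)" if "b \<in> B" for b
      using B \<open>c \<in> B\<close> that by (auto simp: orthonormal_basis_of_def pairwise_def orthogonal_def norm_eq_1)
    then show ?thesis
      using that fin by (simp add: inner_sum_left if_distrib[of "(*) _"] del: if_split cong: if_cong sum.cong)
  qed
  have "f c \<in> {-R..R}" if "(\<Sum>b\<in>B. f b *\<^sub>R b) \<in> P" "c \<in> B" for f c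
  proof -
    have "\<bar>f c\<bar> \<le> norm (\<Sum>b\<in>B. f b *\<^sub>R b) * norm c"
      using Cauchy_Schwarz_ineq2 comp[OF that(2)] by metis
    also have "\<dots> \<le> R"
      using R[OF that(1)] B that(2) by (simp add: orthonormal_basis_of_def)
    finally show ?thesis by auto
  qed
  then have "(\<lambda>f. \<Sum>b\<in>B. f b *\<^sub>R b) -` P \<inter> space (\<Pi>\<^sub>M b\<in>B. lborel) \<subseteq> (\<Pi>\<^sub>E b\<in>B. {-R..R})"
    by (auto simp: space_PiM PiE_iff)
  then have "emeasure (subspace_lborel S) P \<le> emeasure (\<Pi>\<^sub>M b\<in>B. lborel) (\<Pi>\<^sub>E b\<in>B. {-R..R})"
    unfolding eq using fin by (subst emeasure_distr) (auto intro!: emeasure_mono sets_PiM_I_finite)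
  also have "\<dots> = (\<Prod>b\<in>B. emeasure lborel {-R..R})"
    using fin by (intro emeasure_PiM) auto
  also have "\<dots> < \<infinity>"
    by (simp add: emeasure_lborel_Icc_eq ennreal_power power_less_top_ennreal)
  finally show ?thesis .
qed

section \<open>Volume lost under translation\<close>

text \<open>For compact \<open>K\<close> this is \<open>measure lebesgue K\<close> minus the
  covariogram of \<open>K\<close> at \<open>v\<close>.\<close>

definition shift_defect :: "'a::euclidean_space set \<Rightarrow> 'a \<Rightarrow> real" where
  "shift_defect K v = measure lebesgue {x \<in> K. x + v \<notin> K}"

text \<open>Space is sliced into lines parallel to \<open>v\<close>, indexed by their points
  \<open>\<sigma> f\<close> in the orthogonal hyperplane. A line contributes at most
  \<open>norm v\<close>, and contributes nothing unless \<open>\<sigma> f\<close> lies in the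
  projection of \<open>K\<close>.\<close>

lemma shift_defect_le_proj_vol:
  fixes K :: "'a::euclidean_space set"
  assumes "compact K" and "convex K" and v: "v \<noteq> 0"
  shows "shift_defect K v \<le> norm v * proj_vol K v"
proof -
  obtain B where B: "orthonormal_basis_of (orth_hyperplane v) B"
    and eq: "subspace_lborel (orth_hyperplane v) = distr (\<Pi>\<^sub>M b\<in>B. lborel) borel (\<lambda>f. \<Sum>b\<in>B. f b *\<^sub>R b)"
    by (rule subspace_lborel_eq[OF subspace_orth_hyperplane])
  note fin = orthonormal_basis_of_finite_independent(1)[OF B]
  interpret product_sigma_finite "\<lambda>_::'a. lborel :: real measure" ..
  define u where "u = v /\<^sub>R norm v"
  note uB = orthonormal_basis_of_insert_normal[OF v B, folded u_def]
  have vu: "v = norm v *\<^sub>R u" using v by (simp add: u_def)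
  define \<sigma> :: "('a \<Rightarrow> real) \<Rightarrow> 'a" where "\<sigma> f = (\<Sum>b\<in>B. f b *\<^sub>R b)" for f
  have \<sigma>[measurable]: "\<sigma> \<in> borel_measurable (\<Pi>\<^sub>M b\<in>B. lborel)"
    unfolding \<sigma>_def by measurable
  have \<sigma>_orth: "v \<bullet> \<sigma> f = 0" for f
  proof -
    have "\<sigma> f \<in> span B" unfolding \<sigma>_def by (intro span_sum span_scale span_base)
    then show ?thesis using B by (simp add: orthonormal_basis_of_def orth_hyperplane_def orthogonal_def)
  qed
  define P where "P = proj_orth v ` K"
  define D where "D = {x \<in> K. x + v \<notin> K}"
  have [measurable]: "K \<in> sets borel"
    using assms(1) by (simp add: borel_compact)
  have D[measurable]: "D \<in> sets borel" unfolding D_def by measurable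
  have "continuous_on K (proj_orth v)"
    unfolding proj_orth_def by (intro continuous_intros) (use v in auto)
  then have cP: "compact P"
    unfolding P_def using assms(1) by (rule compact_continuous_image)
  then have P[measurable]: "P \<in> sets borel" by (simp add: borel_compact)
  have line: "(\<integral>\<^sup>+t. indicator D (t *\<^sub>R u + \<sigma> f) \<partial>lborel) \<le> ennreal (norm v) * indicator P (\<sigma> f)" for f
  proof (cases "\<sigma> f \<in> P")
    case True
    let ?A = "{t. t *\<^sub>R u + \<sigma> f \<in> D}"
    have "t - s \<le> norm v" if s: "s \<in> ?A" and t: "t \<in> ?A" for s t
    proof (rule ccontr)
      assume "\<not> t - s \<le> norm v"
      then have less: "norm v < t - s" by simp
      \<comment> \<open>With this weight the convex combination of the points at parameters
        \<open>s\<close> and \<open>t\<close> is the point at \<open>s + norm v\<close>, the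
        translate by \<open>v\<close> of the point at \<open>s\<close>. Convexity puts it in
        \<open>K\<close>, although points of \<open>D\<close> are moved out of
        \<open>K\<close>.\<close>
      define l where "l = norm v / (t - s)"
      have ts: "t - s > 0" using less norm_ge_zero[of v] by linarith
      then have l: "0 \<le> l" "l \<le> 1" using less by (auto simp: l_def)
      have "l * (t - s) = norm v" using ts by (simp add: l_def)
      then have ls: "(1 - l) * s + l * t = s + norm v" by (simp add: algebra_simps)
      have "(1 - l) *\<^sub>R (s *\<^sub>R u + \<sigma> f) + l *\<^sub>R (t *\<^sub>R u + \<sigma> f) \<in> K"
        using s t l by (intro convexD[OF \<open>convex K\<close>]) (auto simp: D_def)
      moreover have "(1 - l) *\<^sub>R (s *\<^sub>R u + \<sigma> f) + l *\<^sub>R (t *\<^sub>R u + \<sigma> f)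
          = ((1 - l) * s + l * t) *\<^sub>R u + \<sigma> f"
        by (simp add: algebra_simps)
      moreover have "\<dots> = s *\<^sub>R u + \<sigma> f + v"
        unfolding ls scaleR_add_left vu[symmetric] by simp
      ultimately show False using s by (simp add: D_def)
    qed
    then have "emeasure lborel ?A \<le> ennreal (norm v)"
      by (intro emeasure_lborel_le_diameter) auto
    moreover have "(\<integral>\<^sup>+t. indicator D (t *\<^sub>R u + \<sigma> f) \<partial>lborel) = (\<integral>\<^sup>+t. indicator ?A t \<partial>lborel)"
      by (intro nn_integral_cong) (simp add: indicator_def)
    moreover have "(\<integral>\<^sup>+t. indicator ?A t \<partial>lborel) = emeasure lborel ?A"
      by (rule nn_integral_indicator) measurable
    ultimately show ?thesis using True by simp
  next
    case False
    have "t *\<^sub>R u + \<sigma> f \<notin> D" for t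
    proof
      assume "t *\<^sub>R u + \<sigma> f \<in> D"
      moreover have "proj_orth v (t *\<^sub>R u + \<sigma> f) = \<sigma> f"
        using v by (simp add: proj_orth_def inner_add_right \<sigma>_orth u_def)
      ultimately have "\<sigma> f \<in> P" by (metis (no_types, lifting) D_def P_def image_eqI mem_Collect_eq)
      with False show False ..
    qed
    then show ?thesis by simp
  qed
  have "emeasure lborel D = (\<integral>\<^sup>+x. indicator D x \<partial>lborel)" by simp
  also have "\<dots> = (\<integral>\<^sup>+f. indicator D (\<Sum>b\<in>insert u B. f b *\<^sub>R b) \<partial>(\<Pi>\<^sub>M b\<in>insert u B. lborel))"
    by (subst lborel_eq_orthonormal_basis[OF uB(2)], subst nn_integral_distr) simp_all
  \<comment> \<open>Fubini: the coordinate along \<open>u\<close> is integrated first.\<close>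
  also have "\<dots> = (\<integral>\<^sup>+f. (\<integral>\<^sup>+t. indicator D (\<Sum>b\<in>insert u B. (f(u := t)) b *\<^sub>R b) \<partial>lborel) \<partial>(\<Pi>\<^sub>M b\<in>B. lborel))"
    using fin uB(1) by (intro product_nn_integral_insert) measurable
  also have "\<dots> = (\<integral>\<^sup>+f. (\<integral>\<^sup>+t. indicator D (t *\<^sub>R u + \<sigma> f) \<partial>lborel) \<partial>(\<Pi>\<^sub>M b\<in>B. lborel))"
  proof -
    have "(\<Sum>b\<in>insert u B. (f(u := t)) b *\<^sub>R b) = t *\<^sub>R u + \<sigma> f" for f t
    proof -
      have "(\<Sum>b\<in>B. (f(u := t)) b *\<^sub>R b) = \<sigma> f"
        unfolding \<sigma>_def using uB(1) by (intro sum.cong) auto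
      then show ?thesis using fin uB(1) by simp
    qed
    then show ?thesis by simp
  qed
  also have "\<dots> \<le> (\<integral>\<^sup>+f. ennreal (norm v) * indicator P (\<sigma> f) \<partial>(\<Pi>\<^sub>M b\<in>B. lborel))"
    by (intro nn_integral_mono line)
  also have "\<dots> = ennreal (norm v) * (\<integral>\<^sup>+f. indicator P (\<sigma> f) \<partial>(\<Pi>\<^sub>M b\<in>B. lborel))"
    by (intro nn_integral_cmult) measurable
  also have "(\<integral>\<^sup>+f. indicator P (\<sigma> f) \<partial>(\<Pi>\<^sub>M b\<in>B. lborel)) = emeasure (subspace_lborel (orth_hyperplane v)) P"
  proof -
    have "(\<integral>\<^sup>+f. indicator P (\<sigma> f) \<partial>(\<Pi>\<^sub>M b\<in>B. lborel))
        = (\<integral>\<^sup>+x. indicator P x \<partial>distr (\<Pi>\<^sub>M b\<in>B. lborel) borel \<sigma>)"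
      by (subst nn_integral_distr) simp_all
    then show ?thesis by (simp add: eq \<sigma>_def[abs_def])
  qed
  \<comment> \<open>\<open>measure\<close> sends an infinite value to 0, so the compactness of the
    projection is used to exclude that case.\<close>
  also have "\<dots> = ennreal (proj_vol K v)"
    unfolding proj_vol_def P_def[symmetric]
    using emeasure_subspace_lborel_bounded_finite[OF subspace_orth_hyperplane compact_imp_bounded[OF cP] P]
    by (intro emeasure_eq_ennreal_measure) (auto simp: top.not_eq_extremum)
  finally have "emeasure lborel D \<le> ennreal (norm v * proj_vol K v)"
    by (simp add: ennreal_mult' proj_vol_def)
  then have "measure lborel D \<le> norm v * proj_vol K v"
    unfolding measure_def by (intro enn2real_leI) (auto simp: proj_vol_def)
  then show ?thesis
    unfolding shift_defect_def D_def[symmetric] by simp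
qed

lemma lmeasurable_shift_diff:
  fixes K :: "'a::euclidean_space set"
  assumes "compact K"
  shows "{x \<in> K. x + v \<notin> K} \<in> lmeasurable"
proof -
  have "{x \<in> K. x + v \<notin> K} = K - (\<lambda>x. x - v) ` K"
    by (auto simp: image_iff algebra_simps)
  then show ?thesis
    using assms by (simp add: fmeasurable.Diff lmeasurable_compact measurable_translation_subtract)
qed

lemma shift_defect_0 [simp]: "shift_defect K 0 = 0"
  by (simp add: shift_defect_def)

text \<open>Perform the shift in two stages: a point lost under \<open>v + w\<close> is either lost
  under \<open>v\<close>, or moved by \<open>v\<close> to a point lost under \<open>w\<close>. The
  points of the second kind lie in a translate of the set lost under \<open>w\<close>.\<close>

lemma shift_defect_add_le:
  fixes K :: "'a::euclidean_space set"
  assumes K: "compact K"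
  shows "shift_defect K (v + w) \<le> shift_defect K v + shift_defect K w"
proof -
  let ?A = "\<lambda>v. {x \<in> K. x + v \<notin> K}"
  let ?B = "(\<lambda>x. x - v) ` ?A w"
  note meas = lmeasurable_shift_diff[OF K] measurable_translation_subtract[OF lmeasurable_shift_diff[OF K]]
  have "?A (v + w) \<subseteq> ?A v \<union> ?B"
  proof
    fix x assume x: "x \<in> ?A (v + w)"
    show "x \<in> ?A v \<union> ?B"
    proof (cases "x + v \<in> K")
      case True
      then have "x + v \<in> ?A w" using x by (simp add: add.assoc)
      then have "x \<in> ?B" by (intro image_eqI[of _ _ "x + v"]) simp_all
      then show ?thesis by blast
    qed (use x in simp)
  qed
  then have "measure lebesgue (?A (v + w)) \<le> measure lebesgue (?A v \<union> ?B)"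
    using meas by (intro measure_mono_fmeasurable fmeasurableD fmeasurable.Un)
  also have "\<dots> \<le> measure lebesgue (?A v) + measure lebesgue ?B"
    using meas by (intro measure_Un_le fmeasurableD)
  finally show ?thesis
    by (simp add: shift_defect_def measure_translation_subtract)
qed

lemma proj_vol_scaleR:
  assumes "t \<noteq> 0"
  shows "proj_vol K (t *\<^sub>R x) = proj_vol K x"
proof -
  have "orth_hyperplane (t *\<^sub>R x) = orth_hyperplane x"
    using assms by (simp add: orth_hyperplane_def orthogonal_def)
  moreover have "proj_orth (t *\<^sub>R x) = proj_orth x"
    using assms by (simp add: proj_orth_def fun_eq_iff)
  ultimately show ?thesis by (simp add: proj_vol_def)
qed

text \<open>The projection volume depends only on the direction, so the Fubini bound for
  \<open>t *\<^sub>R x\<close> is \<open>t\<close> times the norm of \<open>x\<close>. A zero shift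
  is treated apart, because that bound concerns nonzero directions.\<close>

lemma shift_defect_polar_proj_body_le:
  fixes K :: "'a::euclidean_space set"
  assumes "compact K" and "convex K" and x: "x \<in> polar_proj_body K" and "0 \<le> t"
  shows "shift_defect K (t *\<^sub>R x) \<le> t"
proof (cases "t *\<^sub>R x = 0")
  case False
  then have "shift_defect K (t *\<^sub>R x) \<le> norm (t *\<^sub>R x) * proj_vol K (t *\<^sub>R x)"
    using assms by (intro shift_defect_le_proj_vol)
  also have "\<dots> = t * polar_proj_norm K x"
    using False \<open>0 \<le> t\<close> by (simp add: proj_vol_scaleR polar_proj_norm_def)
  also have "\<dots> \<le> t"
    using x \<open>0 \<le> t\<close> by (simp add: polar_proj_body_def mult_left_le)
  finally show ?thesis .
qed (use assms in auto)

section \<open>Overlap of \<open>K\<close> with translates of the reflected \<open>L\<close>\<close>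

lemma lmeasurable_conv_vol_set:
  fixes K L :: "'a::euclidean_space set"
  assumes "compact K" and "compact L"
  shows "K \<inter> (\<lambda>y. x - y) ` L \<in> lmeasurable"
  using assms by (intro lmeasurable_compact compact_Int compact_continuous_image continuous_intros)

text \<open>If \<open>x\<close> lies in \<open>K\<close> and in the reflection of \<open>L\<close>,
  and neither the shift of \<open>K\<close> by \<open>p\<close> nor that of the reflection by
  \<open>- q\<close> loses it, then \<open>x + p\<close> lies in the overlap that
  \<open>conv_vol K L (p + q)\<close> measures. So the original overlap is covered by a translate of
  the new one and the two lost sets.\<close>

lemma conv_vol_add_ge:
  fixes K L :: "'a::euclidean_space set"
  assumes K: "compact K" and L: "compact L"
  shows "measure lebesgue (K \<inter> uminus ` L) - shift_defect K p - shift_defect L q \<le> conv_vol K L (p + q)"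
proof -
  define E where "E = (\<lambda>x. x - p) ` (K \<inter> (\<lambda>y. p + q - y) ` L)"
  have E: "E \<in> lmeasurable" "measure lebesgue E = conv_vol K L (p + q)"
    unfolding E_def conv_vol_def
    using lmeasurable_conv_vol_set[OF K L, of "p + q"]
    by (simp_all add: measurable_translation_subtract measure_translation_subtract)
  let ?A = "{x \<in> K. x + p \<notin> K}"
  let ?B = "{x \<in> uminus ` L. x + - q \<notin> uminus ` L}"
  have A: "?A \<in> lmeasurable" by (rule lmeasurable_shift_diff[OF K])
  have "compact (uminus ` L)"
    using L by (intro compact_continuous_image continuous_intros)
  then have B: "?B \<in> lmeasurable" by (rule lmeasurable_shift_diff)
  \<comment> \<open>Reflection exchanges the shift by \<open>- q\<close> of the reflected body with
    the shift by \<open>q\<close> of \<open>L\<close>, and it preserves volume.\<close>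
  have "?B = uminus ` {y \<in> L. y + q \<notin> L}"
  proof (intro set_eqI)
    fix x
    have im: "z \<in> uminus ` M \<longleftrightarrow> - z \<in> M" for z and M :: "'a set"
      by (metis image_iff minus_minus)
    show "x \<in> ?B \<longleftrightarrow> x \<in> uminus ` {y \<in> L. y + q \<notin> L}"
      unfolding im mem_Collect_eq by (simp add: algebra_simps)
  qed
  then have mB: "measure lebesgue ?B = shift_defect L q"
    using measure_lebesgue_affine[of "-1" 0 "{y \<in> L. y + q \<notin> L}"]
    by (simp add: shift_defect_def)
  have "K \<inter> uminus ` L \<subseteq> (E \<union> ?A) \<union> ?B"
  proof
    fix x assume x: "x \<in> K \<inter> uminus ` L"
    show "x \<in> (E \<union> ?A) \<union> ?B"
    proof (rule ccontr)
      assume not: "x \<notin> (E \<union> ?A) \<union> ?B"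
      then have "x + p \<in> K" "x - q \<in> uminus ` L" using x by auto
      then obtain y where y: "y \<in> L" "x - q = - y" by blast
      then have "x + p = p + q - y" by (simp add: algebra_simps)
      then have "x + p \<in> K \<inter> (\<lambda>y. p + q - y) ` L"
        using y \<open>x + p \<in> K\<close> by blast
      then have "x \<in> E" unfolding E_def by (intro image_eqI[of _ _ "x + p"]) simp_all
      with not show False by blast
    qed
  qed
  moreover have "K \<inter> uminus ` L \<in> lmeasurable"
    using K \<open>compact (uminus ` L)\<close> by (intro lmeasurable_compact compact_Int)
  ultimately have "measure lebesgue (K \<inter> uminus ` L) \<le> measure lebesgue ((E \<union> ?A) \<union> ?B)"
    using A B E by (intro measure_mono_fmeasurable fmeasurableD fmeasurable.Un)
  also have "\<dots> \<le> measure lebesgue (E \<union> ?A) + measure lebesgue ?B"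
    using A B E by (intro measure_Un_le fmeasurableD fmeasurable.Un)
  also have "measure lebesgue (E \<union> ?A) \<le> measure lebesgue E + measure lebesgue ?A"
    using A E by (intro measure_Un_le fmeasurableD)
  finally show ?thesis
    unfolding mB E by (simp add: shift_defect_def)
qed

text \<open>For interior points \<open>k\<close> and \<open>l\<close>, a neighbourhood of
  \<open>k\<close> lies both in \<open>K\<close> and in the reflected copy of \<open>L\<close> moved
  by \<open>k + l\<close>, so this overlap has positive volume.\<close>

lemma max_conv_vol_pos:
  fixes K L :: "'a::euclidean_space set"
  assumes "convex_body K" and "convex_body L"
  shows "0 < max_conv_vol K L"
proof -
  have comp: "compact K" "compact L"
    using assms by (auto simp: convex_body_def)
  obtain k l where kl: "k \<in> interior K" "l \<in> interior L"
    using assms by (auto simp: convex_body_def)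
  let ?x = "k + l"
  let ?U = "interior K \<inter> (\<lambda>y. ?x - y) -` interior L"
  have "open ?U"
    by (intro open_Int open_interior open_vimage continuous_intros)
  moreover have "k \<in> ?U" using kl by simp
  ultimately have "\<not> negligible ?U" using open_not_negligible by blast
  moreover have "?U \<subseteq> K \<inter> (\<lambda>y. ?x - y) ` L"
  proof
    fix z assume z: "z \<in> ?U"
    then have "z \<in> K" "?x - z \<in> L" using interior_subset by auto
    moreover have "z = ?x - (?x - z)" by simp
    ultimately show "z \<in> K \<inter> (\<lambda>y. ?x - y) ` L" by blast
  qed
  ultimately have "\<not> negligible (K \<inter> (\<lambda>y. ?x - y) ` L)"
    using negligible_subset by blast
  then have "0 < conv_vol K L ?x"
    using lmeasurable_conv_vol_set[OF comp, of ?x]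
    by (simp add: negligible_iff_measure conv_vol_def zero_less_measure_iff)
  \<comment> \<open>A real \<open>SUP\<close> dominates its members only when they are bounded
    above; the volume of \<open>K\<close> is a bound.\<close>
  also have "\<dots> \<le> max_conv_vol K L"
    unfolding max_conv_vol_def
  proof (rule cSUP_upper)
    show "?x \<in> K + L" using kl interior_subset by (intro set_plus_intro) auto
    have "conv_vol K L x \<le> measure lebesgue K" for x
      unfolding conv_vol_def using lmeasurable_conv_vol_set[OF comp, of x] lmeasurable_compact[OF comp(1)]
      by (intro measure_mono_fmeasurable fmeasurableD) auto
    then show "bdd_above (conv_vol K L ` (K + L))"
      by (intro bdd_aboveI2)
  qed
  finally show ?thesis .
qed

section \<open>Points of the convex hull as sums of a shift of \<open>K\<close> and a shift of
  \<open>L\<close>\<close>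

theorem proposition4p3:
  fixes K L :: "(real ^ 'n) set" and \<theta> :: real
  assumes "convex_body K" and "convex_body L"
    and "max_conv_vol K L = measure lebesgue (K \<inter> uminus ` L)"
    and "0 < \<theta>" and "\<theta> < 1"
  shows "(\<lambda>x. ((1 - \<theta>) * max_conv_vol K L) *\<^sub>R x) `
           (convex hull (polar_proj_body K \<union> polar_proj_body L))
         \<subseteq> theta_conv \<theta> K L"
proof
  fix z assume "z \<in> (\<lambda>x. ((1 - \<theta>) * max_conv_vol K L) *\<^sub>R x) `
           (convex hull (polar_proj_body K \<union> polar_proj_body L))"
  then obtain x where x: "x \<in> convex hull (polar_proj_body K \<union> polar_proj_body L)"
    and z: "z = ((1 - \<theta>) * max_conv_vol K L) *\<^sub>R x" by blast
  let ?M = "max_conv_vol K L"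
  have K: "compact K" "convex K" and L: "compact L" "convex L"
    using assms by (auto simp: convex_body_def)
  have M: "0 < ?M" using assms by (intro max_conv_vol_pos)
  \<comment> \<open>\<open>W\<close> collects the \<open>x\<close> whose multiples
    \<open>t *\<^sub>R x\<close> split into two shifts of total loss at most \<open>t\<close>.
    Asking this for all \<open>t \<ge> 0\<close> makes convexity direct: a combination with weights
    \<open>a\<close> and \<open>b\<close> uses the condition at \<open>t * a\<close> and
    \<open>t * b\<close>, and subadditivity adds the losses. A point of either polar body puts the
    entire shift on its own body.\<close>
  define W where "W = {x. \<forall>t\<ge>0. \<exists>p q. p + q = t *\<^sub>R x \<and> shift_defect K p + shift_defect L q \<le> t}"
  have "polar_proj_body K \<subseteq> W"
  proof
    fix x assume x: "x \<in> polar_proj_body K"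
    have "t *\<^sub>R x + 0 = t *\<^sub>R x \<and> shift_defect K (t *\<^sub>R x) + shift_defect L 0 \<le> t" if "0 \<le> t" for t
      using shift_defect_polar_proj_body_le[OF K x that] by simp
    then show "x \<in> W" unfolding W_def by blast
  qed
  moreover have "polar_proj_body L \<subseteq> W"
  proof
    fix x assume x: "x \<in> polar_proj_body L"
    have "0 + t *\<^sub>R x = t *\<^sub>R x \<and> shift_defect K 0 + shift_defect L (t *\<^sub>R x) \<le> t" if "0 \<le> t" for t
      using shift_defect_polar_proj_body_le[OF L x that] by simp
    then show "x \<in> W" unfolding W_def by blast
  qed
  moreover have "convex W"
  proof (rule convexI)
    fix x y and a b :: real
    assume x: "x \<in> W" and y: "y \<in> W" and ab: "0 \<le> a" "0 \<le> b" "a + b = 1"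
    show "a *\<^sub>R x + b *\<^sub>R y \<in> W"
      unfolding W_def
    proof (clarify)
      fix t :: real assume t: "0 \<le> t"
      obtain p q where pq: "p + q = (t * a) *\<^sub>R x" "shift_defect K p + shift_defect L q \<le> t * a"
        using x mult_nonneg_nonneg[OF t ab(1)] unfolding W_def by blast
      obtain p' q' where pq': "p' + q' = (t * b) *\<^sub>R y" "shift_defect K p' + shift_defect L q' \<le> t * b"
        using y mult_nonneg_nonneg[OF t ab(2)] unfolding W_def by blast
      have "(p + p') + (q + q') = (p + q) + (p' + q')" by simp
      also have "\<dots> = t *\<^sub>R (a *\<^sub>R x + b *\<^sub>R y)"
        unfolding pq(1) pq'(1) by (simp add: scaleR_add_right)
      finally have "(p + p') + (q + q') = t *\<^sub>R (a *\<^sub>R x + b *\<^sub>R y)" .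
      moreover have "t * a + t * b = t" using ab by (simp flip: distrib_left)
      then have "shift_defect K (p + p') + shift_defect L (q + q') \<le> t"
        using pq(2) pq'(2) shift_defect_add_le[OF K(1), of p p'] shift_defect_add_le[OF L(1), of q q']
        by linarith
      ultimately show "\<exists>p q. p + q = t *\<^sub>R (a *\<^sub>R x + b *\<^sub>R y) \<and> shift_defect K p + shift_defect L q \<le> t"
        by blast
    qed
  qed
  ultimately have "convex hull (polar_proj_body K \<union> polar_proj_body L) \<subseteq> W"
    by (intro hull_minimal) auto
  with x have "x \<in> W" by blast
  moreover have "0 \<le> (1 - \<theta>) * ?M" using M assms by simp
  ultimately obtain p q where pq: "p + q = z"
    "shift_defect K p + shift_defect L q \<le> (1 - \<theta>) * ?M"
    unfolding W_def z by blast
  \<comment> \<open>The overlap at the origin has the maximal volume \<open>?M\<close> by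
    assumption, so a loss of at most \<open>(1 - \<theta>) * ?M\<close> leaves at least
    \<open>\<theta> * ?M\<close>.\<close>
  have "\<theta> * ?M = ?M - (1 - \<theta>) * ?M" by (simp add: algebra_simps)
  also have "\<dots> \<le> measure lebesgue (K \<inter> uminus ` L) - shift_defect K p - shift_defect L q"
    using pq(2) assms(3) by simp
  also have "\<dots> \<le> conv_vol K L z"
    using conv_vol_add_ge[OF K(1) L(1), of p q] pq(1) by simp
  finally have ge: "\<theta> * ?M \<le> conv_vol K L z" .
  \<comment> \<open>Positive overlap volume forces a common point, and such a point exhibits
    \<open>z\<close> as an element of \<open>K + L\<close>.\<close>
  moreover have "0 < \<theta> * ?M" using M assms by simp
  ultimately have "conv_vol K L z \<noteq> 0" by linarith
  then have "K \<inter> (\<lambda>y. z - y) ` L \<noteq> {}" unfolding conv_vol_def by (metis measure_empty)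
  then obtain y where "y \<in> L" "z - y \<in> K" by blast
  then have "z \<in> K + L" using set_plus_intro[of "z - y" K y L] by simp
  with ge show "z \<in> theta_conv \<theta> K L" by (simp add: theta_conv_def)
qed

end
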